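(* Let $r\ge 1$, let $\mathbf a=(a_1,\ldots,a_r)$ be a sequence of positive integers, and let $D$ be a positive common multiple of $a_1,\ldots,a_r$. For every integer $n\ge 0$, $$ p_{\mathbf a}(n) = \frac{1}{(r-1)!} \sum_{\substack{0\leq j_1\leq \frac{D}{a_1}-1,\ldots, 0\leq j_r\leq \frac{D}{a_r}-1 \\ a_1j_1+\cdots+a_rj_r \equiv n \ (\mathrm{mod}\ D)}} \ \prod_{\ell=1}^{r-1} \left(\frac{n-a_1j_{1}- \cdots -a_rj_r}{D}+\ell \right).$$
   Context: $p_{\mathbf a}(n)$ (the restricted partition function) is the number of integer solutions $(x_1,\ldots,x_r)$ of $\sum_{i=1}^r a_ix_i=n$ with all $x_i\ge 0$. The sum is over integer tuples $(j_1,\ldots,j_r)$; an empty product equals $1$. *)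

theory Defs
  imports Complex_Main "HOL-Library.FuncSet" "HOL-Number_Theory.Cong"
begin

(* An r-tuple is an element of {1..r} \<rightarrow>\<^sub>E _, i.e. a function that is undefined
   outside {1..r}, so each tuple is represented (and counted) exactly once.
   For positive a 1, ..., a r the set below is finite, so card is its true cardinality. *)
definition restricted_partition :: "nat \<Rightarrow> (nat \<Rightarrow> nat) \<Rightarrow> nat \<Rightarrow> nat" where
  "restricted_partition r a n =
     card {x \<in> {1..r} \<rightarrow>\<^sub>E (UNIV :: nat set). (\<Sum>i=1..r. a i * x i) = n}"

end

theory Submission
  imports Defs
begin

text \<open>
  Write \<open>b\<^sub>i = D / a\<^sub>i\<close>. Division with remainder by \<open>b\<^sub>i\<close> splits every solution uniquely as
  \<open>x\<^sub>i = j\<^sub>i + b\<^sub>i q\<^sub>i\<close> with \<open>0 \<le> j\<^sub>i < b\<^sub>i\<close>, and because \<open>a\<^sub>i b\<^sub>i = D\<close> for every \<open>i\<close> the equation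
  \<open>\<Sum> a\<^sub>i x\<^sub>i = n\<close> becomes \<open>\<Sum> a\<^sub>i j\<^sub>i + D \<Sum> q\<^sub>i = n\<close>. For a fixed remainder tuple \<open>j\<close> this has a
  solution only if \<open>m = (n - \<Sum> a\<^sub>i j\<^sub>i) / D\<close> is an integer, and then \<open>q\<close> ranges over the weak
  compositions of \<open>m\<close> into \<open>r\<close> parts (\<open>card_remainder_fibres\<close>). If \<open>m \<ge> 0\<close> there are
  \<open>(m + r - 1 choose m) = (m + 1) \<cdots> (m + r - 1) / (r - 1)!\<close> of them, which is the summand at \<open>j\<close>.

  The formula also sums over tuples with \<open>m < 0\<close>, to which no solution belongs. These terms vanish:
  each \<open>a\<^sub>i j\<^sub>i\<close> is less than \<open>D\<close>, so \<open>m > -r\<close>, and one of the factors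
  \<open>m + 1, \<dots>, m + r - 1\<close> is zero.
\<close>

lemma card_weak_compositions:
  assumes "r \<ge> 1"
  shows "card {q \<in> {1..r} \<rightarrow>\<^sub>E (UNIV :: nat set). (\<Sum>i=1..r. q i) = m} = (m + r - 1) choose m"
proof -
  let ?Q = "{q \<in> {1..r} \<rightarrow>\<^sub>E (UNIV :: nat set). (\<Sum>i=1..r. q i) = m}"
  let ?L = "{xs :: nat list. length xs = r \<and> sum_list xs = m}"
  have "bij_betw (\<lambda>q. map q [1..<Suc r]) ?Q ?L"
  proof (rule bij_betw_byWitness[where f' = "\<lambda>xs. \<lambda>i\<in>{1..r}. xs ! (i - 1)"])
    show "\<forall>q\<in>?Q. (\<lambda>i\<in>{1..r}. map q [1..<Suc r] ! (i - 1)) = q"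
    proof
      fix q assume "q \<in> ?Q"
      then show "(\<lambda>i\<in>{1..r}. map q [1..<Suc r] ! (i - 1)) = q"
        by (auto simp: fun_eq_iff restrict_def PiE_def extensional_def simp del: upt_Suc)
    qed
    show "\<forall>xs\<in>?L. map (\<lambda>i\<in>{1..r}. xs ! (i - 1)) [1..<Suc r] = xs"
      by (auto intro!: nth_equalityI simp del: upt_Suc)
    show "(\<lambda>q. map q [1..<Suc r]) ` ?Q \<subseteq> ?L"
      by (auto simp: interv_sum_list_conv_sum_set_nat atLeastLessThanSuc_atLeastAtMost
               simp del: upt_Suc)
    show "(\<lambda>xs. \<lambda>i\<in>{1..r}. xs ! (i - 1)) ` ?L \<subseteq> ?Q"
    proof safe
      fix xs :: "nat list"
      assume r: "r = length xs"
      have "(\<Sum>i=1..length xs. xs ! (i - 1)) = (\<Sum>i<length xs. xs ! i)"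
        by (rule sum.reindex_bij_witness[where i = Suc and j = "\<lambda>i. i - 1"]) auto
      then show "(\<Sum>i=1..length xs. (\<lambda>i\<in>{1..length xs}. xs ! (i - 1)) i) = sum_list xs"
        by (simp add: sum_list_sum_nth atLeast0LessThan)
    qed auto
  qed
  then have "card ?Q = card ?L"
    by (rule bij_betw_same_card)
  then show ?thesis
    using card_length_sum_list[of r m] by simp
qed

lemma prod_shifted_eq_binomial:
  "(\<Prod>l=1..k. real m + real l) = fact k * real ((m + k) choose m)"
proof -
  have "(\<Prod>l=1..k. real m + real l) = fact (m + k) / fact m"
    by (induction k) (simp_all add: algebra_simps)
  then show ?thesis
    by (simp add: binomial_fact)
qed

text \<open>
  The bijection underlying the formula is \<open>(j, q) \<mapsto> (j\<^sub>i + (D / a\<^sub>i) q\<^sub>i)\<^sub>i\<close>, with inverse given by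
  \<open>mod\<close> and \<open>div\<close>. The fibre over \<open>j\<close> is described by an equation in the natural numbers, so that
  it is empty, as it should be, when \<open>\<Sum> a\<^sub>i j\<^sub>i > n\<close>.
\<close>

lemma card_remainder_fibres:
  fixes a :: "nat \<Rightarrow> nat"
  assumes a: "\<forall>i\<in>{1..r}. a i > 0" and D: "D > 0" and dvd: "\<forall>i\<in>{1..r}. a i dvd D"
  shows "restricted_partition r a n =
    (\<Sum>j \<in> {j \<in> (\<Pi>\<^sub>E i\<in>{1..r}. {0..D div a i - 1}). [(\<Sum>i=1..r. a i * j i) = n] (mod D)}.
       card {q \<in> {1..r} \<rightarrow>\<^sub>E (UNIV :: nat set).
               (\<Sum>i=1..r. a i * j i) + D * (\<Sum>i=1..r. q i) = n})"
proof -
  let ?I = "{1..r}"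
  define b where "b i = D div a i" for i
  let ?J = "{j \<in> (\<Pi>\<^sub>E i\<in>?I. {0..D div a i - 1}). [(\<Sum>i=1..r. a i * j i) = n] (mod D)}"
  let ?Q = "\<lambda>j. {q \<in> ?I \<rightarrow>\<^sub>E (UNIV :: nat set).
               (\<Sum>i=1..r. a i * j i) + D * (\<Sum>i=1..r. q i) = n}"
  let ?X = "{x \<in> ?I \<rightarrow>\<^sub>E (UNIV :: nat set). (\<Sum>i=1..r. a i * x i) = n}"
  have ab: "a i * b i = D" and b_pos: "b i > 0" if "i \<in> ?I" for i
  proof -
    show *: "a i * b i = D" using dvd that by (simp add: b_def)
    show "b i > 0" using * D by (cases "b i = 0") auto
  qed
  have J_less: "j i < b i" if "j \<in> ?J" "i \<in> ?I" for j i
  proof -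
    have "j i \<le> b i - 1" using that by (auto simp: b_def PiE_def Pi_def)
    then show ?thesis using b_pos[OF that(2)] by linarith
  qed
  have split_sum: "(\<Sum>i=1..r. a i * (j i + b i * q i)) =
      (\<Sum>i=1..r. a i * j i) + D * (\<Sum>i=1..r. q i)" for j q :: "nat \<Rightarrow> nat"
  proof -
    have "(\<Sum>i=1..r. a i * (j i + b i * q i)) = (\<Sum>i=1..r. a i * j i + D * q i)"
    proof (rule sum.cong[OF refl])
      fix i assume "i \<in> ?I"
      show "a i * (j i + b i * q i) = a i * j i + D * q i"
        unfolding ab[OF \<open>i \<in> ?I\<close>, symmetric] by (simp add: algebra_simps)
    qed
    then show ?thesis
      by (simp add: sum.distrib sum_distrib_left)
  qed
  let ?f = "\<lambda>(j, q). \<lambda>i\<in>?I. j i + b i * q i"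
  let ?g = "\<lambda>x. (\<lambda>i\<in>?I. x i mod b i, \<lambda>i\<in>?I. x i div b i)"
  have "bij_betw ?f (Sigma ?J ?Q) ?X"
  proof (rule bij_betw_byWitness[where f' = ?g])
    show "\<forall>p\<in>Sigma ?J ?Q. ?g (?f p) = p"
    proof
      fix p assume "p \<in> Sigma ?J ?Q"
      then obtain j q where p: "p = (j, q)" and j: "j \<in> ?J" and "q \<in> ?Q j"
        by (rule SigmaE)
      have j': "j \<in> (\<Pi>\<^sub>E i\<in>?I. {0..D div a i - 1})"
        using j unfolding mem_Collect_eq by (rule conjunct1)
      have q: "q \<in> ?I \<rightarrow>\<^sub>E (UNIV :: nat set)"
        using \<open>q \<in> ?Q j\<close> unfolding mem_Collect_eq by (rule conjunct1)
      have *: "j i < b i" if "i \<in> ?I" for i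
        by (rule J_less[OF j that])
      have "(\<lambda>i\<in>?I. (j i + b i * q i) mod b i) = j"
      proof (rule extensionalityI[of _ ?I])
        show "j \<in> extensional ?I" using j' by (simp add: PiE_def)
      qed (use * in auto)
      moreover have "(\<lambda>i\<in>?I. (j i + b i * q i) div b i) = q"
      proof (rule extensionalityI[of _ ?I])
        show "q \<in> extensional ?I" using q by (simp add: PiE_def)
        show "(\<lambda>i\<in>?I. (j i + b i * q i) div b i) i = q i" if "i \<in> ?I" for i
          using *[OF that] that by simp
      qed auto
      ultimately show "?g (?f p) = p"
        unfolding p by (simp cong: restrict_cong)
    qed
    show "\<forall>x\<in>?X. ?f (?g x) = x"
    proof
      fix x assume "x \<in> ?X"
      then have "x \<in> extensional ?I" by (simp add: PiE_def)
      then show "?f (?g x) = x"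
        by (intro extensionalityI[of _ ?I]) simp_all
    qed
    show "?f ` Sigma ?J ?Q \<subseteq> ?X"
    proof
      fix x assume "x \<in> ?f ` Sigma ?J ?Q"
      then obtain p where p: "p \<in> Sigma ?J ?Q" and x: "x = ?f p"
        by (rule imageE)
      obtain j q where [simp]: "p = (j, q)"
        by (cases p)
      have jq: "(\<Sum>i=1..r. a i * j i) + D * (\<Sum>i=1..r. q i) = n"
        using p by simp
      have "(\<Sum>i=1..r. a i * x i) = n"
        using split_sum[of j q] jq by (simp add: x)
      moreover have "x \<in> ?I \<rightarrow>\<^sub>E UNIV"
        by (simp add: x)
      ultimately show "x \<in> ?X" by simp
    qed
    show "?g ` ?X \<subseteq> Sigma ?J ?Q"
    proof
      fix p assume "p \<in> ?g ` ?X"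
      then obtain x where "x \<in> ?X" and p: "p = ?g x"
        by (rule imageE)
      then have x: "(\<Sum>i=1..r. a i * x i) = n" by simp
      let ?j = "\<lambda>i\<in>?I. x i mod b i" and ?q = "\<lambda>i\<in>?I. x i div b i"
      have eq: "(\<Sum>i=1..r. a i * ?j i) + D * (\<Sum>i=1..r. ?q i) = n"
        using split_sum[of ?j ?q] x by simp
      have "[(\<Sum>i=1..r. a i * ?j i) = n] (mod D)"
        unfolding eq[symmetric] by (simp add: cong_def)
      moreover have "?j \<in> (\<Pi>\<^sub>E i\<in>?I. {0..D div a i - 1})"
      proof (rule restrict_PiE_iff[THEN iffD2], rule ballI)
        fix i assume "i \<in> ?I"
        then have "x i mod b i < b i" using b_pos by simp
        then show "x i mod b i \<in> {0..D div a i - 1}" by (auto simp: b_def)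
      qed
      ultimately have "?j \<in> ?J" by simp
      moreover have "?q \<in> ?Q ?j" using eq by simp
      ultimately show "p \<in> Sigma ?J ?Q"
        unfolding p by (rule SigmaI[where B = ?Q])
    qed
  qed
  then have "card ?X = card (Sigma ?J ?Q)"
    by (rule bij_betw_same_card[symmetric])
  also have "\<dots> = (\<Sum>j\<in>?J. card (?Q j))"
  proof (rule card_SigmaI)
    show "finite ?J"
      by (rule finite_subset[of _ "\<Pi>\<^sub>E i\<in>?I. {0..D div a i - 1}"]) (auto intro: finite_PiE)
    show "\<forall>j\<in>?J. finite (?Q j)"
    proof
      fix j
      have "q i \<le> n" if "q \<in> ?Q j" "i \<in> ?I" for q i
      proof -
        have "q i \<le> (\<Sum>i=1..r. q i)" using that(2) by (intro member_le_sum) auto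
        also have "\<dots> \<le> D * (\<Sum>i=1..r. q i)" using D by simp
        also have "\<dots> \<le> n" using that(1) by auto
        finally show ?thesis .
      qed
      then have "?Q j \<subseteq> ?I \<rightarrow>\<^sub>E {0..n}"
        by (auto simp: PiE_def Pi_def)
      then show "finite (?Q j)"
        by (rule finite_subset) (auto intro: finite_PiE)
    qed
  qed
  finally show ?thesis
    unfolding restricted_partition_def .
qed

text \<open>
  The bound \<open>s < n + r D\<close> is what confines a negative quotient \<open>(n - s) / D\<close> to the zeros
  \<open>-1, \<dots>, -(r - 1)\<close> of the product.
\<close>

lemma card_fibre_eq_prod:
  assumes r: "r \<ge> 1" and D: "D > 0" and cong: "[s = n] (mod D)" and bound: "s < n + r * D"
  shows "real (card {q \<in> {1..r} \<rightarrow>\<^sub>E (UNIV :: nat set). s + D * (\<Sum>i=1..r. q i) = n}) =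
    1 / fact (r - 1) * (\<Prod>l=1..r - 1. (real n - real s) / real D + real l)"
proof (cases "s \<le> n")
  case True
  then obtain m where n: "n = s + D * m"
    using cong by (metis cong_sym cong_le_nat mult.commute add.commute)
  have "{q \<in> {1..r} \<rightarrow>\<^sub>E (UNIV :: nat set). s + D * (\<Sum>i=1..r. q i) = n} =
      {q \<in> {1..r} \<rightarrow>\<^sub>E UNIV. (\<Sum>i=1..r. q i) = m}"
    using D by (auto simp: n)
  moreover have "(real n - real s) / real D = real m"
    using D by (simp add: n)
  ultimately show ?thesis
    using prod_shifted_eq_binomial[where m = m and k = "r - 1"] card_weak_compositions[OF r, of m] r by simp
next
  case False
  then obtain k where s: "s = n + D * k"
    using cong by (metis cong_le_nat mult.commute add.commute nat_le_linear)
  have "k \<ge> 1" using False s by (cases k) auto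
  moreover have "k < r" using bound D by (simp add: s mult.commute)
  moreover have "(real n - real s) / real D = - real k"
    using D by (simp add: s)
  ultimately have "(\<Prod>l=1..r - 1. (real n - real s) / real D + real l) = 0"
    by (intro prod_zero bexI[of _ k]) auto
  moreover have "{q \<in> {1..r} \<rightarrow>\<^sub>E (UNIV :: nat set). s + D * (\<Sum>i=1..r. q i) = n} = {}"
    using False by auto
  ultimately show ?thesis by (simp only: card.empty of_nat_0 mult_zero_right)
qed

theorem corollary1p10:
  fixes r :: nat and a :: "nat \<Rightarrow> nat" and D :: nat and n :: nat
  assumes "r \<ge> 1"
    and "\<forall>i\<in>{1..r}. a i > 0"
    and "D > 0"
    and "\<forall>i\<in>{1..r}. a i dvd D"
  shows "real (restricted_partition r a n) =
    1 / fact (r - 1) *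
      (\<Sum>j \<in> {j \<in> (\<Pi>\<^sub>E i\<in>{1..r}. {0..D div a i - 1}). [(\<Sum>i=1..r. a i * j i) = n] (mod D)}.
         \<Prod>l=1..r - 1. (real n - (\<Sum>i=1..r. real (a i) * real (j i))) / real D + real l)"
proof -
  let ?J = "{j \<in> (\<Pi>\<^sub>E i\<in>{1..r}. {0..D div a i - 1}). [(\<Sum>i=1..r. a i * j i) = n] (mod D)}"
  have fibre: "real (card {q \<in> {1..r} \<rightarrow>\<^sub>E (UNIV :: nat set).
               (\<Sum>i=1..r. a i * j i) + D * (\<Sum>i=1..r. q i) = n}) =
      1 / fact (r - 1) *
        (\<Prod>l=1..r - 1. (real n - (\<Sum>i=1..r. real (a i) * real (j i))) / real D + real l)"
    if j: "j \<in> ?J" for j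
  proof -
    have "(\<Sum>i=1..r. a i * j i) < (\<Sum>i=1..r. D)"
    proof (rule sum_strict_mono)
      fix i assume i: "i \<in> {1..r}"
      then have aD: "a i * (D div a i) = D" and "a i > 0" using assms by auto
      have "D div a i > 0" using aD assms(3) by (cases "D div a i = 0") auto
      moreover have "j i \<le> D div a i - 1" using j i by (auto simp: PiE_def Pi_def)
      ultimately have "j i < D div a i" by linarith
      then have "a i * j i < a i * (D div a i)" using \<open>a i > 0\<close> by simp
      then show "a i * j i < D" unfolding aD .
    qed (use assms(1) in auto)
    then have "(\<Sum>i=1..r. a i * j i) < n + r * D" by simp
    from card_fibre_eq_prod[OF assms(1,3) _ this] j show ?thesis by simp
  qed
  have "real (restricted_partition r a n) = (\<Sum>j\<in>?J. real (card {q \<in> {1..r} \<rightarrow>\<^sub>E (UNIV :: nat set).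
               (\<Sum>i=1..r. a i * j i) + D * (\<Sum>i=1..r. q i) = n}))"
    by (simp add: card_remainder_fibres[OF assms(2-4)])
  also have "\<dots> = (\<Sum>j\<in>?J. 1 / fact (r - 1) *
        (\<Prod>l=1..r - 1. (real n - (\<Sum>i=1..r. real (a i) * real (j i))) / real D + real l))"
    by (intro sum.cong refl fibre)
  finally show ?thesis
    by (simp only: sum_distrib_left)
qed

end
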